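(* Let $p\in(0,1)$ and let $(\hat U_n)_{n\ge 1}$ be the reinforced sequence of uniform variables on $[0,1]$ produced by Simon's algorithm with reinforcement parameter $p$. With probability one, it holds that $$\lim_{n\to\infty}\ \sup_{0\le x\le 1}\left|\frac1n\sum_{i=1}^n\left(\mathbf 1_{\hat U_i\le x}-x\right)\right|=0.$$
   Context: Simon's algorithm. Fix $p\in(0,1)$. Let $(\varepsilon_n)_{n\ge 2}$ be i.i.d. Bernoulli variables with parameter $p$ (so $\mathbb P(\varepsilon_n=1)=p$), and set $\varepsilon_1=0$. Let $(v(n))_{n\ge2}$ be independent variables with $v(n)$ uniform on $\{1,\ldots,n-1\}$. Let $(U_j)_{j\ge1}$ be i.i.d. uniform variables on $[0,1]$. The three sequences $(\varepsilon_n)$, $(v(n))$, $(U_j)$ are independent. Let $\mathrm i(n)=\sum_{j=1}^n(1-\varepsilon_j)$ be the number of innovations after $n$ steps. Define recursively, for $n\ge1$, $\hat U_n=\hat U_{v(n)}$ if $\varepsilon_n=1$, and $\hat U_n=U_{\mathrm i(n)}$ if $\varepsilon_n=0$. *)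

theory Defs
  imports "HOL-Probability.Probability"
begin

definition innovations :: "(nat \<Rightarrow> bool) \<Rightarrow> nat \<Rightarrow> nat" where
  "innovations \<epsilon> n = (\<Sum>j = 1..n. 1 - of_bool (\<epsilon> j))"

text \<open>
  Simon's recursion along one realisation of the data; \<open>\<epsilon> n\<close> stands for the event that the
  \<open>n\<close>-th Bernoulli variable is 1.  The guard \<open>v n \<in> {1..<n}\<close> only serves termination: under the
  laws required below it holds almost surely for all \<open>n \<ge> 2\<close>, and step 1 is never a repetition
  (see the lemma \<open>AE_reinforced\<close>).  The value at index 0 is irrelevant.
\<close>

fun reinforced :: "(nat \<Rightarrow> bool) \<Rightarrow> (nat \<Rightarrow> nat) \<Rightarrow> (nat \<Rightarrow> 'a) \<Rightarrow> nat \<Rightarrow> 'a" where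
  "reinforced \<epsilon> v U n =
     (if \<epsilon> n \<and> v n \<in> {1..<n} then reinforced \<epsilon> v U (v n) else U (innovations \<epsilon> n))"

declare reinforced.simps [simp del]

text \<open>The events generated by the random variables \<open>X n\<close>, \<open>n \<in> I\<close>, with values in \<open>N\<close>.\<close>

definition generated_events ::
    "'w measure \<Rightarrow> 'b measure \<Rightarrow> (nat \<Rightarrow> 'w \<Rightarrow> 'b) \<Rightarrow> nat set \<Rightarrow> 'w set set" where
  "generated_events M N X I =
     sigma_sets (space M) (\<Union>n\<in>I. {X n -` A \<inter> space M | A. A \<in> sets N})"

text \<open>
  The three sequences take values in different types, so their joint independence is expressed
  through the sigma-algebras they generate, indexed by the following type.
\<close>

datatype source = Reinforcement | Choice | Innovation

locale simon_algorithm = prob_space M for M :: "'w measure" +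
  fixes p :: real
    and \<epsilon> :: "nat \<Rightarrow> 'w \<Rightarrow> bool"
    and v :: "nat \<Rightarrow> 'w \<Rightarrow> nat"
    and U :: "nat \<Rightarrow> 'w \<Rightarrow> real"
  assumes p: "0 < p" "p < 1"
    and eps_first: "\<And>\<omega>. \<omega> \<in> space M \<Longrightarrow> \<not> \<epsilon> 1 \<omega>"
    and eps_indep: "indep_vars (\<lambda>_. count_space UNIV) \<epsilon> {2..}"
    and eps_distr: "\<And>n. n \<ge> 2 \<Longrightarrow> distr M (count_space UNIV) (\<epsilon> n) = measure_pmf (bernoulli_pmf p)"
    and v_indep: "indep_vars (\<lambda>_. count_space UNIV) v {2..}"
    and v_distr: "\<And>n. n \<ge> 2 \<Longrightarrow> distr M (count_space UNIV) (v n) = measure_pmf (pmf_of_set {1..<n})"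
    and U_indep: "indep_vars (\<lambda>_. borel) U {1..}"
    and U_distr: "\<And>j. j \<ge> 1 \<Longrightarrow> distr M borel (U j) = uniform_measure lborel {0..1}"
    and sources_indep:
      "indep_sets (\<lambda>s. case s of
           Reinforcement \<Rightarrow> generated_events M (count_space UNIV) \<epsilon> {2..}
         | Choice \<Rightarrow> generated_events M (count_space UNIV) v {2..}
         | Innovation \<Rightarrow> generated_events M borel U {1..}) UNIV"
begin

definition U_hat :: "nat \<Rightarrow> 'w \<Rightarrow> real" where
  "U_hat n \<omega> = reinforced (\<lambda>k. \<epsilon> k \<omega>) (\<lambda>k. v k \<omega>) (\<lambda>k. U k \<omega>) n"

lemma AE_v: "AE \<omega> in M. \<forall>n\<ge>2. v n \<omega> \<in> {1..<n}"
proof -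
  have "AE \<omega> in M. v n \<omega> \<in> {1..<n}" if n: "n \<ge> 2" for n
  proof -
    have [measurable]: "v n \<in> M \<rightarrow>\<^sub>M count_space UNIV"
      using v_indep n by (auto simp: indep_vars_def)
    have "AE k in distr M (count_space UNIV) (v n). k \<in> {1..<n}"
      using n by (simp only: v_distr[OF n] AE_measure_pmf_iff) (subst set_pmf_of_set, auto)
    then show ?thesis
      by (subst (asm) AE_distr_iff) auto
  qed
  then show ?thesis
    by (simp add: AE_all_countable AE_impI)
qed

lemma AE_reinforced:
  "AE \<omega> in M. \<forall>n\<ge>1. U_hat n \<omega> =
     (if \<epsilon> n \<omega> then U_hat (v n \<omega>) \<omega> else U (innovations (\<lambda>k. \<epsilon> k \<omega>) n) \<omega>)"
  using AE_v AE_space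
proof eventually_elim
  case (elim \<omega>)
  show ?case
  proof (intro allI impI)
    fix n :: nat assume "n \<ge> 1"
    then have "v n \<omega> \<in> {1..<n}" if "\<epsilon> n \<omega>"
      using elim eps_first[of \<omega>] that by (cases "n = 1") auto
    then show "U_hat n \<omega> =
       (if \<epsilon> n \<omega> then U_hat (v n \<omega>) \<omega> else U (innovations (\<lambda>k. \<epsilon> k \<omega>) n) \<omega>)"
      unfolding U_hat_def by (subst reinforced.simps) auto
  qed
qed

end

end

theory Submission
  imports Defs
begin

text \<open>
  Fix \<open>x\<close> and let \<open>S n\<close> be the sum of the centred indicators of \<open>U_hat i \<le> x\<close> for \<open>i \<le> n\<close>.
  Given the first \<open>n\<close> steps, the next indicator repeats a uniformly chosen earlier one with
  probability \<open>p\<close> and is centred otherwise, so its conditional mean is \<open>p S n / n\<close>.  Hence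
  \<open>E (S (n + 1))\<^sup>2 \<le> (1 + 2 p / n) E (S n)\<^sup>2 + 1\<close>, and as \<open>p < 1\<close> this makes
  \<open>\<Sum>n. E (S n)\<^sup>2 / n\<^sup>3\<close> finite.  So almost surely \<open>\<Sum>n. (S n / n)\<^sup>2 / n\<close> converges; since \<open>S\<close>
  moves by at most 1 per step, a single large value of \<open>S n / n\<close> would contribute a fixed amount
  to a late block of this series, and therefore \<open>S n / n\<close> tends to 0.  Monotonicity in \<open>x\<close>
  upgrades convergence at rational points to uniform convergence.
\<close>

section \<open>Deterministic estimates\<close>

text \<open>A value \<open>\<bar>S n\<bar> \<ge> e * n\<close> decays slowly:
  \<open>\<bar>S k\<bar>\<close> stays above \<open>e * n / 2\<close> for about
  \<open>e * n / 2\<close> further indices, and these contribute at least \<open>e ^ 3 / 128\<close>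
  to the series. For large \<open>n\<close> this contradicts the Cauchy criterion.\<close>

lemma slowly_varying_div_tendsto_0:
  fixes S :: "nat \<Rightarrow> real"
  assumes lip: "\<And>n. \<bar>S (Suc n) - S n\<bar> \<le> 1"
    and sum: "summable (\<lambda>n. (S n)\<^sup>2 / real n ^ 3)"
  shows "(\<lambda>n. S n / real n) \<longlonglongrightarrow> 0"
proof (rule LIMSEQ_I)
  fix r :: real assume "r > 0"
  \<comment> \<open>Capping at 1 keeps the block of indices used below inside
    \<open>{n..2 * n}\<close>, where \<open>k ^ 3\<close> is comparable with
    \<open>n ^ 3\<close>.\<close>
  define e where "e = min r 1"
  have e: "0 < e" "e \<le> 1" "e \<le> r" using \<open>r > 0\<close> by (auto simp: e_def)
  have "e ^ 3 / 128 > 0" using e by simp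
  then obtain N where N: "\<And>m n. N \<le> m \<Longrightarrow> \<bar>\<Sum>k = m..<n. (S k)\<^sup>2 / real k ^ 3\<bar> < e ^ 3 / 128"
    using sum by (metis summable_Cauchy real_norm_def)
  have lip': "\<bar>S (n + j) - S n\<bar> \<le> real j" for n j
  proof (induction j)
    case (Suc j)
    then show ?case using lip[of "n + j"] by simp
  qed simp
  show "\<exists>no. \<forall>n\<ge>no. norm (S n / real n - 0) < r"
  proof (intro exI[of _ "max N (nat \<lceil>4 / e\<rceil> + 1)"] allI impI)
    fix n assume n: "n \<ge> max N (nat \<lceil>4 / e\<rceil> + 1)"
    then have n0: "n > 0" "4 / e \<le> real n" "N \<le> n" by linarith+
    then have en: "4 \<le> e * real n" using e by (simp add: field_simps)
    have "\<bar>S n\<bar> < e * real n"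
    proof (rule ccontr)
      assume "\<not> ?thesis"
      then have big: "\<bar>S n\<bar> \<ge> e * real n" by simp
      \<comment> \<open>As \<open>4 \<le> e * n\<close>, the number \<open>e * n / 2\<close> is at
        least 2, so rounding down keeps at least half of it; hence the \<open>4 / e\<close> in the
        threshold.\<close>
      define L where "L = nat \<lfloor>e * real n / 2\<rfloor>"
      have L: "real L \<le> e * real n / 2" "real L \<ge> e * real n / 4"
        using en unfolding L_def by linarith+
      have summand: "e\<^sup>2 / (32 * real n) \<le> (S k)\<^sup>2 / real k ^ 3" if k: "k \<in> {n..<n + L}" for k
      proof -
        have "real (k - n) \<le> e * real n / 2" using k L by auto
        then have Sk: "e * real n / 2 \<le> \<bar>S k\<bar>"
          using lip'[of n "k - n"] k big by (simp del: of_nat_diff)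
        have "(e * real n / 2)\<^sup>2 \<le> \<bar>S k\<bar>\<^sup>2"
          using Sk e by (intro power_mono) auto
        then have Sk2: "(e * real n / 2)\<^sup>2 \<le> (S k)\<^sup>2" by simp
        have "e * real n \<le> 1 * real n"
          using e by (intro mult_right_mono) auto
        then have k2: "real k \<le> 2 * real n" using k L by auto
        have k0: "real k > 0" using k n0 by auto
        have "e\<^sup>2 / (32 * real n) = (e * real n / 2)\<^sup>2 / (2 * real n) ^ 3"
          using n0 by (simp add: field_simps power2_eq_square power3_eq_cube)
        also have "\<dots> \<le> (S k)\<^sup>2 / real k ^ 3"
          using power_mono[OF k2, of 3] k0 by (intro frac_le[OF _ Sk2]) auto
        finally show ?thesis .
      qed
      have "e ^ 3 / 128 = (e * real n / 4) * (e\<^sup>2 / (32 * real n))"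
        using n0 by (simp add: field_simps power2_eq_square power3_eq_cube)
      also have "\<dots> \<le> real L * (e\<^sup>2 / (32 * real n))"
        using L by (intro mult_right_mono) auto
      also have "\<dots> \<le> (\<Sum>k = n..<n + L. (S k)\<^sup>2 / real k ^ 3)"
        using sum_bounded_below[of "{n..<n + L}" "e\<^sup>2 / (32 * real n)" "\<lambda>k. (S k)\<^sup>2 / real k ^ 3"] summand
        by simp
      finally show False using N[OF n0(3), of "n + L"] by linarith
    qed
    then have "\<bar>S n\<bar> / real n < e" using n0 by (simp add: field_simps)
    then show "norm (S n / real n - 0) < r" using e by simp
  qed
qed

text \<open>The normalised sequence \<open>b n = a n / n\<^sup>2\<close> drops at each step by at
  least a fixed multiple of \<open>a n / n ^ 3\<close>, up to the summable error
  \<open>c (Suc n)\<close>. Telescoping then bounds the partial sums.\<close>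

lemma summable_div_cube_if_recursion:
  fixes a :: "nat \<Rightarrow> real"
  assumes p: "0 \<le> p" "p < 1" and nonneg: "\<And>n. 0 \<le> a n"
    and rec: "\<And>n. 1 \<le> n \<Longrightarrow> a (Suc n) \<le> (1 + 2 * p / real n) * a n + 1"
  shows "summable (\<lambda>n. a n / real n ^ 3)"
proof -
  define b where "b n = a n / (real n)\<^sup>2" for n
  define c where "c n = 1 / (real n)\<^sup>2" for n
  have "summable c"
    unfolding c_def using inverse_power_summable[of 2, where 'a = real] by (simp add: inverse_eq_divide)
  have b0: "0 \<le> b n" for n by (simp add: b_def nonneg)
  have step: "a n / real n ^ 3 \<le> 2 / (1 - p) * (b n - b (Suc n) + c (Suc n))" if n: "1 \<le> n" for n
  proof -
    define x where "x = real n"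
    have x: "1 \<le> x" using n by (simp add: x_def)
    have "b (Suc n) \<le> ((1 + 2 * p / x) * a n + 1) / (x + 1)\<^sup>2"
      unfolding b_def x_def using rec[OF n] by (simp add: add.commute divide_right_mono)
    then have "b (Suc n) - c (Suc n) \<le> (1 + 2 * p / x) * a n / (x + 1)\<^sup>2"
      unfolding c_def x_def by (simp add: add_divide_distrib add.commute)
    then have "b n - b (Suc n) + c (Suc n) \<ge> a n / x\<^sup>2 - (1 + 2 * p / x) * a n / (x + 1)\<^sup>2"
      by (simp add: b_def x_def)
    \<comment> \<open>The bracket is \<open>(x + 1)\<^sup>2 - (1 + 2 * p / x) * x\<^sup>2\<close>:
      the quadratic terms cancel, and the linear one is positive because
      \<open>p < 1\<close>.\<close>
    moreover have "a n / x\<^sup>2 - (1 + 2 * p / x) * a n / (x + 1)\<^sup>2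
        = a n * (2 * (1 - p) * x + 1) / (x\<^sup>2 * (x + 1)\<^sup>2)"
      using x by (simp add: divide_simps) (simp add: power2_eq_square algebra_simps)
    \<comment> \<open>The lower bound is chosen so that \<open>(x + 1)\<^sup>2\<close> cancels and a
      multiple of \<open>a n / x ^ 3\<close> remains; it rests on
      \<open>x + 1 \<le> 2 * x\<close>.\<close>
    moreover have "a n * (2 * (1 - p) * x + 1) / (x\<^sup>2 * (x + 1)\<^sup>2)
        \<ge> a n * ((1 - p) * (x + 1)\<^sup>2 / (2 * x)) / (x\<^sup>2 * (x + 1)\<^sup>2)"
    proof (intro divide_right_mono mult_left_mono nonneg)
      have "(x + 1)\<^sup>2 \<le> (2 * x)\<^sup>2" using x by (intro power_mono) auto
      then have "(1 - p) * (x + 1)\<^sup>2 \<le> (1 - p) * (2 * x)\<^sup>2" using p by (intro mult_left_mono) auto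
      then have "(1 - p) * (x + 1)\<^sup>2 / (2 * x) \<le> (1 - p) * (2 * x)\<^sup>2 / (2 * x)"
        using x by (intro divide_right_mono) auto
      also have "\<dots> = 2 * (1 - p) * x" using x by (simp add: power2_eq_square)
      finally show "(1 - p) * (x + 1)\<^sup>2 / (2 * x) \<le> 2 * (1 - p) * x + 1" by simp
    qed (use x in auto)
    moreover have "a n * ((1 - p) * (x + 1)\<^sup>2 / (2 * x)) / (x\<^sup>2 * (x + 1)\<^sup>2) = (1 - p) / 2 * (a n / x ^ 3)"
      using x by (simp add: divide_simps power2_eq_square power3_eq_cube)
    ultimately have "(1 - p) / 2 * (a n / x ^ 3) \<le> b n - b (Suc n) + c (Suc n)" by linarith
    then have "2 / (1 - p) * ((1 - p) / 2 * (a n / x ^ 3)) \<le> 2 / (1 - p) * (b n - b (Suc n) + c (Suc n))"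
      using p by (intro mult_left_mono) auto
    then show ?thesis using p by (simp add: x_def)
  qed
  have "(\<Sum>i<n. a (Suc i) / real (Suc i) ^ 3) \<le> 2 / (1 - p) * (b 1 + suminf c)" for n
  proof -
    have "(\<Sum>i<n. a (Suc i) / real (Suc i) ^ 3)
        \<le> (\<Sum>i<n. 2 / (1 - p) * (b (Suc i) - b (Suc (Suc i)) + c (Suc (Suc i))))"
      by (intro sum_mono step) simp
    also have "\<dots> = 2 / (1 - p) * ((\<Sum>i<n. b (Suc i) - b (Suc (Suc i))) + (\<Sum>i<n. c (Suc (Suc i))))"
      by (simp only: sum_distrib_left[symmetric] sum.distrib)
    also have "(\<Sum>i<n. b (Suc i) - b (Suc (Suc i))) = b 1 - b (Suc n)"
      using sum_lessThan_telescope'[of "\<lambda>i. b (Suc i)" n] by simp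
    also have "(\<Sum>i<n. c (Suc (Suc i))) = sum c {2..<n + 2}"
      by (rule sum.reindex_bij_witness[of _ "\<lambda>i. i - 2" "\<lambda>i. i + 2"]) auto
    also have "2 / (1 - p) * (b 1 - b (Suc n) + sum c {2..<n + 2}) \<le> 2 / (1 - p) * (b 1 + suminf c)"
    proof (intro mult_left_mono)
      have "sum c {2..<n + 2} \<le> suminf c"
        using \<open>summable c\<close> by (intro sum_le_suminf) (auto simp: c_def)
      then show "b 1 - b (Suc n) + sum c {2..<n + 2} \<le> b 1 + suminf c"
        using b0[of "Suc n"] by linarith
    qed (use p in auto)
    finally show ?thesis .
  qed
  then have "summable (\<lambda>i. a (Suc i) / real (Suc i) ^ 3)"
    by (intro summableI_nonneg_bounded) (auto simp: nonneg)
  then show ?thesis by (subst (asm) summable_Suc_iff)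
qed

text \<open>Between two grid points monotonicity loses at most the mesh size.\<close>

lemma uniform_limit_of_mono:
  fixes G :: "nat \<Rightarrow> real \<Rightarrow> real"
  assumes mono: "\<And>n. mono (G n)"
    and lim: "\<And>x. x \<in> \<rat> \<Longrightarrow> x \<in> {0..1} \<Longrightarrow> (\<lambda>n. G n x) \<longlonglongrightarrow> x"
  shows "(\<lambda>n. SUP x\<in>{0..1}. \<bar>G n x - x\<bar>) \<longlonglongrightarrow> 0"
proof (rule LIMSEQ_I)
  fix r :: real assume r: "r > 0"
  obtain N where N: "inverse (real (Suc N)) < r / 3"
    using reals_Archimedean[of "r / 3"] r by auto
  define q where "q j = real j / real (Suc N)" for j
  have q01: "q j \<in> {0..1}" "q j \<in> \<rat>" if "j \<le> Suc N" for j
    using that by (auto simp: q_def divide_simps)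
  have "\<forall>\<^sub>F n in sequentially. \<forall>j\<in>{..Suc N}. \<bar>G n (q j) - q j\<bar> < r / 3"
  proof (intro eventually_ball_finite ballI)
    fix j assume "j \<in> {..Suc N}"
    then have "(\<lambda>n. G n (q j)) \<longlonglongrightarrow> q j" using q01 by (intro lim) auto
    then show "\<forall>\<^sub>F n in sequentially. \<bar>G n (q j) - q j\<bar> < r / 3"
      using r by (auto simp: dist_real_def dest: tendstoD[where e = "r / 3"])
  qed auto
  then obtain n0 where n0: "\<And>n j. n \<ge> n0 \<Longrightarrow> j \<le> Suc N \<Longrightarrow> \<bar>G n (q j) - q j\<bar> < r / 3"
    by (auto simp: eventually_sequentially)
  show "\<exists>no. \<forall>n\<ge>no. norm ((SUP x\<in>{0..1}. \<bar>G n x - x\<bar>) - 0) < r"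
  proof (intro exI[of _ n0] allI impI)
    fix n assume n: "n \<ge> n0"
    have bound: "\<bar>G n x - x\<bar> \<le> 2 * r / 3" if x: "x \<in> {0..1}" for x
    proof -
      \<comment> \<open>The minimum with \<open>N\<close> puts \<open>x = 1\<close> into the last
        cell, so that \<open>q (Suc j)\<close> is still a grid point.\<close>
      define j where "j = min N (nat \<lfloor>x * real (Suc N)\<rfloor>)"
      have j: "real j \<le> x * real (Suc N)" "x * real (Suc N) \<le> real (Suc j)"
      proof -
        have xx: "0 \<le> x * real (Suc N)" "x * real (Suc N) \<le> real (Suc N)"
          using x by auto
        then show "real j \<le> x * real (Suc N)" unfolding j_def by linarith
        show "x * real (Suc N) \<le> real (Suc j)"
          using xx unfolding j_def min_def by (auto split: if_splits) linarith+
      qed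
      then have qx: "q j \<le> x" "x \<le> q (Suc j)" by (simp_all add: q_def field_simps)
      have jN: "j \<le> N" by (simp add: j_def)
      have "q (Suc j) - q j = inverse (real (Suc N))" by (simp add: q_def field_simps)
      moreover have "G n (q j) \<le> G n x" "G n x \<le> G n (q (Suc j))"
        using qx mono[of n] by (auto simp: mono_def)
      \<comment> \<open>One third of \<open>r\<close> comes from the mesh, another from the error at
        a neighbouring grid point.\<close>
      ultimately show ?thesis
        using n0[OF n, of j] n0[OF n, of "Suc j"] jN qx N by (auto simp: abs_if split: if_splits)
    qed
    have "(SUP x\<in>{0..1}. \<bar>G n x - x\<bar>) \<le> 2 * r / 3"
      using bound by (intro cSUP_least) auto
    moreover have "0 \<le> \<bar>G n 0 - 0\<bar>" by simp
    moreover have "\<bar>G n 0 - 0\<bar> \<le> (SUP x\<in>{0..1}. \<bar>G n x - x\<bar>)"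
      using bound by (intro cSUP_upper bdd_aboveI2[where M = "2 * r / 3"]) auto
    ultimately show "norm ((SUP x\<in>{0..1}. \<bar>G n x - x\<bar>) - 0) < r" using r by simp
  qed
qed

section \<open>Independence and summability\<close>

text \<open>By monotone convergence the sum of the series has finite expectation, hence is finite
  almost surely.\<close>

lemma (in prob_space) AE_summable_if_summable_expectation:
  fixes f :: "nat \<Rightarrow> 'a \<Rightarrow> real"
  assumes int: "\<And>n. integrable M (f n)" and nonneg: "\<And>n \<omega>. 0 \<le> f n \<omega>"
    and sum: "summable (\<lambda>n. expectation (f n))"
  shows "AE \<omega> in M. summable (\<lambda>n. f n \<omega>)"
proof -
  have [measurable]: "f n \<in> borel_measurable M" for n using int by auto
  have "(\<integral>\<^sup>+ \<omega>. (\<Sum>n. ennreal (f n \<omega>)) \<partial>M) = (\<Sum>n. \<integral>\<^sup>+ \<omega>. ennreal (f n \<omega>) \<partial>M)"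
    by (intro nn_integral_suminf) auto
  also have "\<dots> = (\<Sum>n. ennreal (expectation (f n)))"
    by (intro suminf_cong nn_integral_eq_integral int) (simp add: nonneg)
  also have "\<dots> = ennreal (\<Sum>n. expectation (f n))"
    by (intro suminf_ennreal2 sum Bochner_Integration.integral_nonneg nonneg)
  finally have "(\<integral>\<^sup>+ \<omega>. (\<Sum>n. ennreal (f n \<omega>)) \<partial>M) \<noteq> \<infinity>" by simp
  then have "AE \<omega> in M. (\<Sum>n. ennreal (f n \<omega>)) \<noteq> \<infinity>"
    by (intro nn_integral_PInf_AE) auto
  then show ?thesis
    by eventually_elim (auto intro: summable_suminf_not_top nonneg)
qed

text \<open>Merges independent groups of independent families into one family indexed by pairs. A
  finite intersection is first split over the groups by independence of the generated
  sigma-algebras, then inside each group.\<close>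

lemma (in prob_space) indep_sets_Sigma:
  fixes F :: "'s \<Rightarrow> 'i \<Rightarrow> 'a set set"
  assumes groups: "indep_sets (\<lambda>s. sigma_sets (space M) (\<Union>i\<in>I s. F s i)) S"
    and within: "\<And>s. s \<in> S \<Longrightarrow> indep_sets (F s) (I s)"
  shows "indep_sets (\<lambda>(s, i). F s i) (Sigma S I)"
proof (rule indep_setsI)
  fix si assume "si \<in> Sigma S I"
  then show "(case si of (s, i) \<Rightarrow> F s i) \<subseteq> events"
    using within by (auto simp: indep_sets_def)
next
  fix A and J :: "('s \<times> 'i) set"
  assume J: "J \<noteq> {}" "J \<subseteq> Sigma S I" "finite J" and A: "\<forall>j\<in>J. A j \<in> (case j of (s, i) \<Rightarrow> F s i)"
  define Js where "Js s = {i. (s, i) \<in> J}" for s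
  define B where "B s = (\<Inter>i\<in>Js s. A (s, i))" for s
  have J_eq: "J = Sigma (fst ` J) Js" by (force simp: Js_def)
  have fin: "finite (Js s)" for s
    using finite_imageI[OF \<open>finite J\<close>, of snd] by (rule finite_subset[rotated]) (force simp: Js_def)
  have ne: "Js s \<noteq> {}" if "s \<in> fst ` J" for s using that by (auto simp: Js_def)
  have S: "fst ` J \<subseteq> S" and Js: "Js s \<subseteq> I s" for s using J by (auto simp: Js_def)
  have AF: "A (s, i) \<in> F s i" if "i \<in> Js s" for s i using A that by (auto simp: Js_def)
  have "prob (\<Inter>j\<in>J. A j) = prob (\<Inter>s\<in>fst ` J. B s)"
    by (subst J_eq) (auto intro!: arg_cong[where f = prob] simp: B_def)
  also have "\<dots> = (\<Prod>s\<in>fst ` J. prob (B s))"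
  proof (rule indep_setsD[OF groups S])
    show "\<forall>s\<in>fst ` J. B s \<in> sigma_sets (space M) (\<Union>i\<in>I s. F s i)"
    proof
      fix s assume s: "s \<in> fst ` J"
      then have "s \<in> S" using S by auto
      then have "F s i \<subseteq> Pow (space M)" if "i \<in> I s" for i
        using within[of s] that sets.space_closed[of M] unfolding indep_sets_def by blast
      then interpret sigma_algebra "space M" "sigma_sets (space M) (\<Union>i\<in>I s. F s i)"
        by (intro sigma_algebra_sigma_sets) auto
      show "B s \<in> sigma_sets (space M) (\<Union>i\<in>I s. F s i)"
        unfolding B_def using fin ne[OF s] AF Js by (intro finite_INT) (blast intro: sigma_sets.Basic)+
    qed
  qed (use J in auto)
  also have "\<dots> = (\<Prod>s\<in>fst ` J. \<Prod>i\<in>Js s. prob (A (s, i)))"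
    unfolding B_def
  proof (intro prod.cong refl)
    fix s assume s: "s \<in> fst ` J"
    then have "s \<in> S" using S by auto
    then show "prob (\<Inter>i\<in>Js s. A (s, i)) = (\<Prod>i\<in>Js s. prob (A (s, i)))"
      using AF by (intro indep_setsD[OF within Js ne[OF s] fin]) auto
  qed
  also have "\<dots> = (\<Prod>j\<in>J. prob (A j))"
    using fin J by (subst prod.Sigma) (auto simp: J_eq[symmetric])
  finally show "prob (\<Inter>j\<in>J. A j) = (\<Prod>j\<in>J. prob (A j))" .
qed

text \<open>Allows functions to stay defined on the full index type; they are restricted to
  \<open>A\<close> only where measurability or independence is needed.\<close>

definition depends_only_on :: "(('i \<Rightarrow> 'c) \<Rightarrow> 'b) \<Rightarrow> 'i set \<Rightarrow> bool" where
  "depends_only_on f A \<longleftrightarrow> (\<forall>z z'. (\<forall>i\<in>A. z i = z' i) \<longrightarrow> f z = f z')"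

lemma depends_only_onD: "depends_only_on f A \<Longrightarrow> (\<And>i. i \<in> A \<Longrightarrow> z i = z' i) \<Longrightarrow> f z = f z'"
  unfolding depends_only_on_def by blast

lemma depends_only_on_restrict: "depends_only_on f A \<Longrightarrow> f (restrict z A) = f z"
  by (erule depends_only_onD) simp

text \<open>A finite product of countable discrete spaces is again discrete.\<close>

lemma measurable_PiM_countable:
  fixes f :: "('i \<Rightarrow> 'c :: countable) \<Rightarrow> 'b"
  assumes "finite A" "range f \<subseteq> space N"
  shows "f \<in> PiM A (\<lambda>_. count_space UNIV) \<rightarrow>\<^sub>M N"
  using assms by (subst count_space_PiM_finite) auto

lemma (in prob_space) borel_measurable_depends_only_on:
  fixes Z :: "'i \<Rightarrow> 'a \<Rightarrow> 'c :: countable" and f :: "('i \<Rightarrow> 'c) \<Rightarrow> real"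
  assumes "\<And>i. i \<in> A \<Longrightarrow> random_variable (count_space UNIV) (Z i)" "finite A" "depends_only_on f A"
  shows "(\<lambda>\<omega>. f (\<lambda>i. Z i \<omega>)) \<in> borel_measurable M"
proof -
  have "(\<lambda>\<omega>. f (\<lambda>i\<in>A. Z i \<omega>)) \<in> borel_measurable M"
    using assms
    by (intro measurable_compose[OF measurable_restrict measurable_PiM_countable]) auto
  then show ?thesis using depends_only_on_restrict[OF assms(3)] by simp
qed

lemma (in prob_space) integrable_depends_only_on:
  fixes Z :: "'i \<Rightarrow> 'a \<Rightarrow> 'c :: countable" and f :: "('i \<Rightarrow> 'c) \<Rightarrow> real"
  assumes "\<And>i. i \<in> A \<Longrightarrow> random_variable (count_space UNIV) (Z i)" "finite A" "depends_only_on f A"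
    and "\<And>z. \<bar>f z\<bar> \<le> c"
  shows "integrable M (\<lambda>\<omega>. f (\<lambda>i. Z i \<omega>))"
  using assms borel_measurable_depends_only_on[OF assms(1-3)]
  by (intro integrable_const_bound[where B = c]) auto

text \<open>Takes the place of conditioning on the past: restrictions of an independent family to
  disjoint blocks are independent, so a past factor and a fresh factor separate.\<close>

lemma (in prob_space) expectation_mult_depends_only_on:
  fixes Z :: "'i \<Rightarrow> 'a \<Rightarrow> 'c :: countable" and f g :: "('i \<Rightarrow> 'c) \<Rightarrow> real"
  assumes Z: "indep_vars (\<lambda>_. count_space UNIV) Z K"
    and AB: "A \<inter> B = {}" "A \<subseteq> K" "B \<subseteq> K" "finite A" "finite B"
    and f: "depends_only_on f A" "\<And>z. \<bar>f z\<bar> \<le> c"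
    and g: "depends_only_on g B" "\<And>z. \<bar>g z\<bar> \<le> d"
  shows "expectation (\<lambda>\<omega>. f (\<lambda>i. Z i \<omega>) * g (\<lambda>i. Z i \<omega>)) =
    expectation (\<lambda>\<omega>. f (\<lambda>i. Z i \<omega>)) * expectation (\<lambda>\<omega>. g (\<lambda>i. Z i \<omega>))"
proof (rule indep_var_lebesgue_integral)
  have rv: "random_variable (count_space UNIV) (Z i)" if "i \<in> K" for i
    using Z that by (auto simp: indep_vars_def2)
  show "integrable M (\<lambda>\<omega>. f (\<lambda>i. Z i \<omega>))" "integrable M (\<lambda>\<omega>. g (\<lambda>i. Z i \<omega>))"
    by (rule integrable_depends_only_on[OF _ _ f] integrable_depends_only_on[OF _ _ g]; use AB rv in blast)+
  have "indep_var borel (f \<circ> (\<lambda>\<omega>. \<lambda>i\<in>A. Z i \<omega>)) borel (g \<circ> (\<lambda>\<omega>. \<lambda>i\<in>B. Z i \<omega>))"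
    using AB by (intro indep_var_compose[OF indep_var_restrict[OF Z]] measurable_PiM_countable) auto
  then show "indep_var borel (\<lambda>\<omega>. f (\<lambda>i. Z i \<omega>)) borel (\<lambda>\<omega>. g (\<lambda>i. Z i \<omega>))"
    by (simp add: comp_def depends_only_on_restrict[OF f(1)] depends_only_on_restrict[OF g(1)])
qed

section \<open>Coding of the sources of randomness\<close>

lemma innovations_le: "innovations \<epsilon> n \<le> n"
proof -
  have "innovations \<epsilon> n \<le> (\<Sum>j = 1..n. 1)"
    unfolding innovations_def by (intro sum_mono) auto
  then show ?thesis by simp
qed

lemma innovations_mono: "m \<le> n \<Longrightarrow> innovations \<epsilon> m \<le> innovations \<epsilon> n"
  unfolding innovations_def by (intro sum_mono2) auto

lemma innovations_pos: "\<not> \<epsilon> 1 \<Longrightarrow> 1 \<le> n \<Longrightarrow> 1 \<le> innovations \<epsilon> n"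
  using innovations_mono[of 1 n \<epsilon>] by (simp add: innovations_def)

lemma innovations_cong: "(\<And>k. k \<in> {1..n} \<Longrightarrow> \<epsilon> k = \<epsilon>' k) \<Longrightarrow> innovations \<epsilon> n = innovations \<epsilon>' n"
  unfolding innovations_def by (intro sum.cong) auto

lemma innovations_Suc: "innovations \<epsilon> (Suc n) = innovations \<epsilon> n + (1 - of_bool (\<epsilon> (Suc n)))"
  by (simp add: innovations_def)

text \<open>The recursion only copies values, so it commutes with passing from \<open>U\<close> to
  indicators.\<close>

lemma reinforced_comp: "reinforced \<epsilon> v (\<lambda>j. g (U j)) n = g (reinforced \<epsilon> v U n)"
proof (induction n rule: less_induct)
  case (less n)
  then show ?case
    by (subst (1 2) reinforced.simps) auto
qed

text \<open>Earlier steps have smaller innovation counts, so step \<open>n\<close> reads no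
  innovation beyond \<open>innovations \<epsilon> n\<close>. This sharp range for \<open>U\<close>
  later makes the next innovation independent of the past.\<close>

lemma reinforced_cong:
  assumes "\<not> \<epsilon> 1" "1 \<le> n"
    and "\<And>k. k \<in> {1..n} \<Longrightarrow> \<epsilon> k = \<epsilon>' k"
    and "\<And>k. k \<in> {2..n} \<Longrightarrow> v k = v' k"
    and "\<And>j. j \<in> {1..innovations \<epsilon> n} \<Longrightarrow> U j = U' j"
  shows "reinforced \<epsilon> v U n = reinforced \<epsilon>' v' U' n"
  using assms(2-)
proof (induction n rule: less_induct)
  case (less n)
  have eps: "\<epsilon> n = \<epsilon>' n" using less.prems by auto
  have inno: "innovations \<epsilon>' n = innovations \<epsilon> n"
    using less.prems(2) by (intro innovations_cong) simp
  \<comment> \<open>Agreement of the choices starts at index 2, which suffices because step 1 is not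
    a repetition.\<close>
  have vn: "v n = v' n" if "\<epsilon> n"
    using that less.prems(1,3) assms(1) by (cases "n = 1") auto
  have "reinforced \<epsilon> v U (v n) = reinforced \<epsilon>' v' U' (v n)" if "v n \<in> {1..<n}"
    using that innovations_mono[of "v n" n \<epsilon>] by (intro less.IH less.prems) auto
  moreover have "U (innovations \<epsilon> n) = U' (innovations \<epsilon> n)"
    using innovations_pos[of \<epsilon> n] assms(1) less.prems(1) by (intro less.prems) auto
  ultimately show ?case
    using eps inno vn by (subst (1 2) reinforced.simps) auto
qed

text \<open>The indicators of \<open>U j \<le> x\<close> carry all the information on the innovations that is needed for
  one fixed \<open>x\<close>.  Coding everything by natural numbers makes functions of finitely many
  coordinates trivially measurable.  Index 1 is excluded for the Bernoulli variables since
  \<open>\<epsilon> 1\<close> is not part of the independent family.\<close>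

definition code_eps :: "(source \<times> nat \<Rightarrow> nat) \<Rightarrow> nat \<Rightarrow> bool" where
  "code_eps z k \<longleftrightarrow> 2 \<le> k \<and> z (Reinforcement, k) = 1"

definition code_path :: "(source \<times> nat \<Rightarrow> nat) \<Rightarrow> nat \<Rightarrow> bool" where
  "code_path z n \<longleftrightarrow> reinforced (code_eps z) (\<lambda>k. z (Choice, k)) (\<lambda>j. z (Innovation, j)) n = 1"

text \<open>The bounds are separate because the number of innovations in \<open>n\<close> steps is
  random: \<open>past n n\<close> always determines the first \<open>n\<close> steps,
  \<open>past n m\<close> does so when at most \<open>m\<close> innovations have occurred.\<close>

definition past :: "nat \<Rightarrow> nat \<Rightarrow> (source \<times> nat) set" where
  "past n m = Sigma UNIV (case_source {2..n} {2..n} {1..m})"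

lemma finite_past: "finite (past n m)"
  unfolding past_def
  by (rule finite_subset[of _ "{Reinforcement, Choice, Innovation} \<times> ({2..n} \<union> {1..m})"])
     (auto split: source.splits)

lemma mem_past [simp]:
  "(Reinforcement, k) \<in> past n m \<longleftrightarrow> k \<in> {2..n}"
  "(Choice, k) \<in> past n m \<longleftrightarrow> k \<in> {2..n}"
  "(Innovation, k) \<in> past n m \<longleftrightarrow> k \<in> {1..m}"
  by (auto simp: past_def)

lemma code_eps_cong: "\<forall>i\<in>past n m. z i = z' i \<Longrightarrow> k \<le> n \<Longrightarrow> code_eps z k = code_eps z' k"
  by (auto simp: code_eps_def)

lemma code_innovations_cong:
  "\<forall>i\<in>past n m. z i = z' i \<Longrightarrow> innovations (code_eps z) n = innovations (code_eps z') n"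
  by (intro innovations_cong code_eps_cong) auto

lemma code_path_cong:
  assumes "\<forall>i\<in>past n m. z i = z' i" "i \<in> {1..n}" "innovations (code_eps z) n \<le> m"
  shows "code_path z i = code_path z' i"
  using assms innovations_mono[of i n "code_eps z"] unfolding code_path_def
  by (intro arg_cong[where f = "\<lambda>y. y = 1"] reinforced_cong)
     (auto intro: code_eps_cong simp: code_eps_def)

context simon_algorithm
begin

definition code :: "real \<Rightarrow> source \<times> nat \<Rightarrow> 'w \<Rightarrow> nat" where
  "code x i \<omega> = (case i of
      (Reinforcement, n) \<Rightarrow> of_bool (\<epsilon> n \<omega>)
    | (Choice, n) \<Rightarrow> v n \<omega>
    | (Innovation, n) \<Rightarrow> of_bool (U n \<omega> \<le> x))"

lemma code_simps [simp]:
  "code x (Reinforcement, n) \<omega> = of_bool (\<epsilon> n \<omega>)"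
  "code x (Choice, n) \<omega> = v n \<omega>"
  "code x (Innovation, n) \<omega> = of_bool (U n \<omega> \<le> x)"
  by (simp_all add: code_def)

abbreviation indices :: "(source \<times> nat) set" where
  "indices \<equiv> Sigma UNIV (case_source {2..} {2..} {1..})"

lemma past_subset_indices: "past n m \<subseteq> indices"
  by (auto simp: past_def split: source.splits)

lemma measurable_eps [measurable]: "2 \<le> n \<Longrightarrow> \<epsilon> n \<in> M \<rightarrow>\<^sub>M count_space UNIV"
  and measurable_v [measurable]: "2 \<le> n \<Longrightarrow> v n \<in> M \<rightarrow>\<^sub>M count_space UNIV"
  and measurable_U [measurable]: "1 \<le> n \<Longrightarrow> U n \<in> borel_measurable M"
  using eps_indep v_indep U_indep by (auto simp: indep_vars_def2)

text \<open>The assumptions on the three sequences make all uncoded coordinates independent; each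
  coded event is also an event of its uncoded variable.\<close>

lemma indep_code: "indep_vars (\<lambda>_. count_space UNIV) (code x) indices"
  unfolding indep_vars_def2
proof
  show "\<forall>i\<in>indices. random_variable (count_space UNIV) (code x i)"
  proof (safe, goal_cases)
    case (1 s n)
    have "code x (Reinforcement, n) = (\<lambda>\<omega>. of_bool (\<epsilon> n \<omega>))"
      "code x (Choice, n) = v n" "code x (Innovation, n) = (\<lambda>\<omega>. of_bool (U n \<omega> \<le> x))"
      by (simp_all add: fun_eq_iff)
    with 1 show ?case by (cases s rule: source.exhaust) simp_all
  qed
  define F where "F s n = (case s of
      Reinforcement \<Rightarrow> {\<epsilon> n -` A \<inter> space M |A. A \<in> sets (count_space UNIV)}
    | Choice \<Rightarrow> {v n -` A \<inter> space M |A. A \<in> sets (count_space UNIV)}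
    | Innovation \<Rightarrow> {U n -` A \<inter> space M |A. A \<in> sets borel})" for s n
  have "indep_sets (\<lambda>(s, n). F s n) indices"
  proof (rule indep_sets_Sigma)
    have "(\<lambda>s. sigma_sets (space M) (\<Union>n\<in>case_source {2..} {2..} {1..} s. F s n)) =
      (\<lambda>s. case s of
           Reinforcement \<Rightarrow> generated_events M (count_space UNIV) \<epsilon> {2..}
         | Choice \<Rightarrow> generated_events M (count_space UNIV) v {2..}
         | Innovation \<Rightarrow> generated_events M borel U {1..})"
      by (auto simp: F_def generated_events_def fun_eq_iff split: source.splits)
    then show "indep_sets (\<lambda>s. sigma_sets (space M) (\<Union>n\<in>case_source {2..} {2..} {1..} s. F s n)) UNIV"
      using sources_indep by simp
    show "indep_sets (F s) (case_source {2..} {2..} {1..} s)" for s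
      using eps_indep v_indep U_indep unfolding indep_vars_def2 F_def by (cases s) simp_all
  qed
  then show "indep_sets (\<lambda>i. {code x i -` A \<inter> space M |A. A \<in> sets (count_space UNIV)}) indices"
  proof (rule indep_sets_mono_sets, intro subsetI)
    fix i :: "source \<times> nat" and E
    assume "E \<in> {code x i -` A \<inter> space M |A. A \<in> sets (count_space UNIV)}"
    then obtain A where A: "E = code x i -` A \<inter> space M" by blast
    obtain s n where i: "i = (s, n)" by (cases i)
    have "E \<in> F s n"
    proof (cases s)
      case Reinforcement
      have "E = \<epsilon> n -` {b. of_bool b \<in> A} \<inter> space M"
        unfolding A i Reinforcement by auto
      then show ?thesis unfolding F_def Reinforcement by auto
    next
      case Choice
      have "E = v n -` A \<inter> space M"
        unfolding A i Choice by auto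
      then show ?thesis unfolding F_def Choice by auto
    next
      case Innovation
      have "E = U n -` {u. of_bool (u \<le> x) \<in> A} \<inter> space M"
        unfolding A i Innovation by auto
      \<comment> \<open>The indicator takes two values, so the preimage is a union of at most two
        half-lines and thus Borel.\<close>
      moreover have "{u. (of_bool (u \<le> x) :: nat) \<in> A} =
          (if 1 \<in> A then {..x} else {}) \<union> (if 0 \<in> A then {x<..} else {})"
        by (auto simp: of_bool_def not_le)
      then have "{u. (of_bool (u \<le> x) :: nat) \<in> A} \<in> sets borel" by auto
      ultimately show ?thesis unfolding F_def Innovation source.case by blast
    qed
    then show "E \<in> (case i of (s, n) \<Rightarrow> F s n)" by (simp add: i)
  qed
qed

lemma measurable_code: "i \<in> indices \<Longrightarrow> random_variable (count_space UNIV) (code x i)"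
  using indep_code[of x] unfolding indep_vars_def2 by blast

lemma eps_eq_code: "\<omega> \<in> space M \<Longrightarrow> 1 \<le> k \<Longrightarrow> code_eps (\<lambda>i. code x i \<omega>) k = \<epsilon> k \<omega>"
  using eps_first[of \<omega>] by (cases "k = 1") (auto simp: code_eps_def)

lemma innovations_eq_code:
  "\<omega> \<in> space M \<Longrightarrow> innovations (code_eps (\<lambda>i. code x i \<omega>)) n = innovations (\<lambda>k. \<epsilon> k \<omega>) n"
  by (intro innovations_cong eps_eq_code) auto

lemma U_hat_le_iff_code:
  assumes "\<omega> \<in> space M" "1 \<le> n"
  shows "U_hat n \<omega> \<le> x \<longleftrightarrow> code_path (\<lambda>i. code x i \<omega>) n"
proof -
  have "reinforced (code_eps (\<lambda>i. code x i \<omega>)) (\<lambda>k. v k \<omega>) (\<lambda>j. of_bool (U j \<omega> \<le> x)) n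
      = (reinforced (\<lambda>k. \<epsilon> k \<omega>) (\<lambda>k. v k \<omega>) (\<lambda>j. of_bool (U j \<omega> \<le> x)) n :: nat)"
    using assms by (intro reinforced_cong eps_eq_code) (auto simp: code_eps_def)
  then show ?thesis
    using reinforced_comp[of _ _ "\<lambda>u. of_bool (u \<le> x) :: nat" "\<lambda>j. U j \<omega>"]
    by (simp add: code_path_def U_hat_def)
qed

section \<open>Expectations of single coordinates\<close>

lemma expectation_eps: "2 \<le> n \<Longrightarrow> expectation (\<lambda>\<omega>. of_bool (\<epsilon> n \<omega>)) = p"
  using integral_distr[of "\<epsilon> n" M "count_space UNIV" "of_bool :: _ \<Rightarrow> real"] p
  by (simp add: eps_distr)

lemma expectation_v:
  assumes "2 \<le> n" "k \<in> {1..<n}"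
  shows "expectation (\<lambda>\<omega>. of_bool (v n \<omega> = k)) = 1 / (real n - 1)"
proof -
  have "expectation (\<lambda>\<omega>. of_bool (v n \<omega> = k)) = (\<integral>j. (of_bool (j = k) :: real) \<partial>measure_pmf (pmf_of_set {1..<n}))"
    using assms by (subst v_distr[symmetric]) (simp_all add: integral_distr[OF measurable_v])
  also have "\<dots> = 1 / (real n - 1)"
    using assms by (subst integral_pmf_of_set) (auto simp: of_bool_def of_nat_diff)
  finally show ?thesis .
qed

lemma expectation_U:
  assumes "1 \<le> j" "x \<in> {0..1}"
  shows "expectation (\<lambda>\<omega>. of_bool (U j \<omega> \<le> x)) = x"
proof -
  have "expectation (\<lambda>\<omega>. of_bool (U j \<omega> \<le> x)) = expectation (indicator (U j -` {..x} \<inter> space M))"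
    by (intro Bochner_Integration.integral_cong) (auto simp: indicator_def)
  also have "\<dots> = measure (distr M borel (U j)) {..x}"
    using assms by (simp add: measure_distr)
  also have "\<dots> = measure lborel ({0..1} \<inter> {..x}) / measure lborel {0..1::real}"
    using assms by (subst U_distr) (auto intro!: measure_uniform_measure)
  also have "{0..1} \<inter> {..x} = {0..x}" using assms by auto
  finally show ?thesis using assms by simp
qed

end

text \<open>The counterpart of \<open>deviation\<close> as a function of the code, to which the
  factorisation of expectations applies.\<close>

definition code_deviation :: "real \<Rightarrow> (source \<times> nat \<Rightarrow> nat) \<Rightarrow> nat \<Rightarrow> real" where
  "code_deviation x z n = (\<Sum>i = 1..n. of_bool (code_path z i) - x)"

lemma abs_of_bool_diff_le: "x \<in> {0..1} \<Longrightarrow> \<bar>of_bool b - x\<bar> \<le> (1 :: real)"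
  by (cases b) auto

lemma abs_code_deviation_le:
  assumes "x \<in> {0..1}"
  shows "\<bar>code_deviation x z n\<bar> \<le> real n"
proof -
  have "\<bar>code_deviation x z n\<bar> \<le> (\<Sum>i = 1..n. \<bar>of_bool (code_path z i) - x\<bar>)"
    unfolding code_deviation_def by (rule sum_abs)
  also have "\<dots> \<le> (\<Sum>i = 1..n. 1)"
    by (intro sum_mono abs_of_bool_diff_le assms)
  finally show ?thesis by simp
qed

lemma code_deviation_cong:
  assumes "\<forall>i\<in>past n m. z i = z' i" "innovations (code_eps z) n \<le> m"
  shows "code_deviation x z n = code_deviation x z' n"
  unfolding code_deviation_def
  by (intro sum.cong refl arg_cong[where f = "\<lambda>b. of_bool b - x"] code_path_cong[OF assms(1) _ assms(2)])

context simon_algorithm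
begin

section \<open>Second moment of the deviation\<close>

definition centred :: "real \<Rightarrow> nat \<Rightarrow> 'w \<Rightarrow> real" where
  "centred x n \<omega> = of_bool (U_hat n \<omega> \<le> x) - x"

definition deviation :: "real \<Rightarrow> nat \<Rightarrow> 'w \<Rightarrow> real" where
  "deviation x n \<omega> = (\<Sum>i = 1..n. centred x i \<omega>)"

lemma deviation_Suc: "deviation x (Suc n) \<omega> = deviation x n \<omega> + centred x (Suc n) \<omega>"
  by (simp add: deviation_def)

lemma centred_eq_code:
  "\<omega> \<in> space M \<Longrightarrow> 1 \<le> n \<Longrightarrow> centred x n \<omega> = of_bool (code_path (\<lambda>i. code x i \<omega>) n) - x"
  by (simp add: centred_def U_hat_le_iff_code)

lemma deviation_eq_code:
  "\<omega> \<in> space M \<Longrightarrow> deviation x n \<omega> = code_deviation x (\<lambda>i. code x i \<omega>) n"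
  by (simp add: deviation_def code_deviation_def centred_eq_code)

lemma measurable_centred:
  assumes "1 \<le> n"
  shows "centred x n \<in> borel_measurable M"
proof -
  have "(\<lambda>\<omega>. of_bool (code_path (\<lambda>i. code x i \<omega>) n) - x) \<in> borel_measurable M"
  proof (rule borel_measurable_depends_only_on[OF measurable_code finite_past[of n n]])
    show "depends_only_on (\<lambda>z. of_bool (code_path z n) - x) (past n n)"
      unfolding depends_only_on_def
    proof (intro allI impI)
      fix z z' :: "source \<times> nat \<Rightarrow> nat" assume "\<forall>i\<in>past n n. z i = z' i"
      then have "code_path z n = code_path z' n"
        using assms innovations_le by (intro code_path_cong) auto
      then show "of_bool (code_path z n) - x = of_bool (code_path z' n) - x" by simp
    qed
  qed (use past_subset_indices in blast)
  then show ?thesis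
    using assms by (subst measurable_cong[OF centred_eq_code]) auto
qed

lemma measurable_deviation [measurable]: "deviation x n \<in> borel_measurable M"
  unfolding deviation_def[abs_def] by (intro borel_measurable_sum measurable_centred) auto

lemma abs_centred_le: "x \<in> {0..1} \<Longrightarrow> \<bar>centred x n \<omega>\<bar> \<le> 1"
  unfolding centred_def by (rule abs_of_bool_diff_le)

lemma abs_deviation_le: "x \<in> {0..1} \<Longrightarrow> \<omega> \<in> space M \<Longrightarrow> \<bar>deviation x n \<omega>\<bar> \<le> real n"
  by (simp add: deviation_eq_code abs_code_deviation_le)

lemma integrable_deviation_times:
  assumes x: "x \<in> {0..1}" and [measurable]: "Y \<in> borel_measurable M"
    and Y: "\<And>\<omega>. \<omega> \<in> space M \<Longrightarrow> \<bar>Y \<omega>\<bar> \<le> c"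
  shows "integrable M (\<lambda>\<omega>. deviation x n \<omega> * Y \<omega>)"
  by (rule integrable_const_bound[where B = "real n * c"])
     (auto simp: abs_mult intro!: mult_mono abs_deviation_le x Y)

lemma integrable_deviation_sq: "x \<in> {0..1} \<Longrightarrow> integrable M (\<lambda>\<omega>. (deviation x n \<omega>)\<^sup>2)"
  unfolding power2_eq_square
  by (intro integrable_deviation_times[where c = "real n"] abs_deviation_le) auto

text \<open>The first two factors depend on \<open>past n n\<close> only; the new coordinates
  \<open>\<epsilon> (Suc n)\<close> and \<open>v (Suc n)\<close> are independent of that and of each
  other, and contribute \<open>p\<close> and \<open>1 / n\<close>.\<close>

lemma expectation_repetition:
  assumes x: "x \<in> {0..1}" and k: "k \<in> {1..n}"
  shows "expectation (\<lambda>\<omega>. deviation x n \<omega> * centred x k \<omega> *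
      (of_bool (\<epsilon> (Suc n) \<omega>) * of_bool (v (Suc n) \<omega> = k))) =
    p / real n * expectation (\<lambda>\<omega>. deviation x n \<omega> * centred x k \<omega>)"
proof -
  define f :: "(source \<times> nat \<Rightarrow> nat) \<Rightarrow> real"
    where "f z = code_deviation x z n * (of_bool (code_path z k) - x)" for z
  define a b :: "(source \<times> nat \<Rightarrow> nat) \<Rightarrow> real"
    where "a z = of_bool (z (Reinforcement, Suc n) = 1)"
      and "b z = of_bool (z (Choice, Suc n) = k)" for z
  have n: "2 \<le> Suc n" using k by auto
  have f_dep: "depends_only_on f (past n n)"
    unfolding depends_only_on_def f_def
  proof (intro allI impI)
    fix z z' :: "source \<times> nat \<Rightarrow> nat" assume z: "\<forall>i\<in>past n n. z i = z' i"
    show "code_deviation x z n * (of_bool (code_path z k) - x) =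
        code_deviation x z' n * (of_bool (code_path z' k) - x)"
      using code_deviation_cong[OF z] code_path_cong[OF z k] innovations_le by simp
  qed
  have f_bound: "\<bar>f z\<bar> \<le> real n * 1" for z
    unfolding f_def abs_mult by (intro mult_mono abs_code_deviation_le abs_of_bool_diff_le x) auto
  have a_dep: "depends_only_on a {(Reinforcement, Suc n)}"
    and b_dep: "depends_only_on b {(Choice, Suc n)}"
    and ab_dep: "depends_only_on (\<lambda>z. a z * b z) {(Reinforcement, Suc n), (Choice, Suc n)}"
    by (simp_all add: depends_only_on_def a_def b_def)
  have ab_bound: "\<bar>a z\<bar> \<le> 1" "\<bar>b z\<bar> \<le> 1" "\<bar>a z * b z\<bar> \<le> 1" for z
    by (simp_all add: a_def b_def)
  have "expectation (\<lambda>\<omega>. a (\<lambda>i. code x i \<omega>) * b (\<lambda>i. code x i \<omega>)) =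
      expectation (\<lambda>\<omega>. a (\<lambda>i. code x i \<omega>)) * expectation (\<lambda>\<omega>. b (\<lambda>i. code x i \<omega>))"
    by (rule expectation_mult_depends_only_on[OF indep_code _ _ _ _ _ a_dep ab_bound(1) b_dep ab_bound(2)])
       (use n in auto)
  also have "\<dots> = p / real n"
    using expectation_eps[OF n] expectation_v[OF n, of k] k by (simp add: a_def b_def del: One_nat_def)
  finally have ab: "expectation (\<lambda>\<omega>. a (\<lambda>i. code x i \<omega>) * b (\<lambda>i. code x i \<omega>)) = p / real n" .
  have f_eq: "deviation x n \<omega> * centred x k \<omega> = f (\<lambda>i. code x i \<omega>)" if "\<omega> \<in> space M" for \<omega>
    using that k by (simp add: f_def deviation_eq_code centred_eq_code)
  have "expectation (\<lambda>\<omega>. deviation x n \<omega> * centred x k \<omega> *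
        (of_bool (\<epsilon> (Suc n) \<omega>) * of_bool (v (Suc n) \<omega> = k))) =
      expectation (\<lambda>\<omega>. f (\<lambda>i. code x i \<omega>) * (a (\<lambda>i. code x i \<omega>) * b (\<lambda>i. code x i \<omega>)))"
    by (intro Bochner_Integration.integral_cong refl) (simp add: f_eq a_def b_def)
  also have "\<dots> = expectation (\<lambda>\<omega>. f (\<lambda>i. code x i \<omega>)) *
      expectation (\<lambda>\<omega>. a (\<lambda>i. code x i \<omega>) * b (\<lambda>i. code x i \<omega>))"
    by (rule expectation_mult_depends_only_on
          [OF indep_code _ past_subset_indices _ finite_past _ f_dep f_bound ab_dep ab_bound(3)])
       (use n in auto)
  also have "expectation (\<lambda>\<omega>. f (\<lambda>i. code x i \<omega>)) =
      expectation (\<lambda>\<omega>. deviation x n \<omega> * centred x k \<omega>)"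
    by (intro Bochner_Integration.integral_cong refl) (simp add: f_eq)
  finally show ?thesis by (simp add: ab)
qed

text \<open>On the event that \<open>m\<close> innovations have occurred so far, the next innovation uses the
  variable \<open>U (Suc m)\<close>, which is independent of the past.\<close>

lemma expectation_innovation:
  assumes x: "x \<in> {0..1}" and n: "1 \<le> n"
  shows "expectation (\<lambda>\<omega>. deviation x n \<omega> * of_bool (innovations (\<lambda>k. \<epsilon> k \<omega>) n = m) *
      (of_bool (\<not> \<epsilon> (Suc n) \<omega>) * (of_bool (U (Suc m) \<omega> \<le> x) - x))) = 0"
proof -
  define f :: "(source \<times> nat \<Rightarrow> nat) \<Rightarrow> real"
    where "f z = code_deviation x z n * of_bool (innovations (code_eps z) n = m)" for z
  define a b :: "(source \<times> nat \<Rightarrow> nat) \<Rightarrow> real"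
    where "a z = of_bool (z (Reinforcement, Suc n) \<noteq> 1)"
      and "b z = of_bool (z (Innovation, Suc m) = 1) - x" for z
  have f_dep: "depends_only_on f (past n m)"
    unfolding depends_only_on_def f_def
  proof (intro allI impI)
    fix z z' :: "source \<times> nat \<Rightarrow> nat" assume z: "\<forall>i\<in>past n m. z i = z' i"
    \<comment> \<open>If the count is \<open>m\<close>, then \<open>past n m\<close> determines the
      deviation; otherwise both sides are 0.\<close>
    show "code_deviation x z n * of_bool (innovations (code_eps z) n = m) =
        code_deviation x z' n * of_bool (innovations (code_eps z') n = m)"
      using code_deviation_cong[OF z] code_innovations_cong[OF z] by auto
  qed
  have f_bound: "\<bar>f z\<bar> \<le> real n * 1" for z
    unfolding f_def abs_mult by (intro mult_mono abs_code_deviation_le x) auto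
  have a_dep: "depends_only_on a {(Reinforcement, Suc n)}"
    and b_dep: "depends_only_on b {(Innovation, Suc m)}"
    and ab_dep: "depends_only_on (\<lambda>z. a z * b z) {(Reinforcement, Suc n), (Innovation, Suc m)}"
    by (simp_all add: depends_only_on_def a_def b_def)
  have ab_bound: "\<bar>a z\<bar> \<le> 1" "\<bar>b z\<bar> \<le> 1" "\<bar>a z * b z\<bar> \<le> 1" for z
    using abs_of_bool_diff_le[OF x, of "z (Innovation, Suc m) = 1"] by (simp_all add: a_def b_def)
  \<comment> \<open>The uniform law gives \<open>U (Suc m) \<le> x\<close> probability exactly
    \<open>x\<close>; a centred factor makes the whole product vanish in mean.\<close>
  have "expectation (\<lambda>\<omega>. b (\<lambda>i. code x i \<omega>)) = expectation (\<lambda>\<omega>. of_bool (U (Suc m) \<omega> \<le> x)) - x"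
    unfolding b_def
    by (subst Bochner_Integration.integral_diff)
       (auto simp: prob_space simp del: One_nat_def intro!: integrable_const_bound[where B = 1])
  then have b: "expectation (\<lambda>\<omega>. b (\<lambda>i. code x i \<omega>)) = 0"
    using x by (simp add: expectation_U)
  have "expectation (\<lambda>\<omega>. a (\<lambda>i. code x i \<omega>) * b (\<lambda>i. code x i \<omega>)) =
      expectation (\<lambda>\<omega>. a (\<lambda>i. code x i \<omega>)) * expectation (\<lambda>\<omega>. b (\<lambda>i. code x i \<omega>))"
    by (rule expectation_mult_depends_only_on[OF indep_code _ _ _ _ _ a_dep ab_bound(1) b_dep ab_bound(2)])
       (use n in auto)
  then have ab: "expectation (\<lambda>\<omega>. a (\<lambda>i. code x i \<omega>) * b (\<lambda>i. code x i \<omega>)) = 0"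
    by (simp add: b)
  have "expectation (\<lambda>\<omega>. deviation x n \<omega> * of_bool (innovations (\<lambda>k. \<epsilon> k \<omega>) n = m) *
        (of_bool (\<not> \<epsilon> (Suc n) \<omega>) * (of_bool (U (Suc m) \<omega> \<le> x) - x))) =
      expectation (\<lambda>\<omega>. f (\<lambda>i. code x i \<omega>) * (a (\<lambda>i. code x i \<omega>) * b (\<lambda>i. code x i \<omega>)))"
    by (intro Bochner_Integration.integral_cong refl)
       (simp add: f_def deviation_eq_code innovations_eq_code a_def b_def)
  also have "\<dots> = expectation (\<lambda>\<omega>. f (\<lambda>i. code x i \<omega>)) *
      expectation (\<lambda>\<omega>. a (\<lambda>i. code x i \<omega>) * b (\<lambda>i. code x i \<omega>))"
    by (rule expectation_mult_depends_only_on
          [OF indep_code _ past_subset_indices _ finite_past _ f_dep f_bound ab_dep ab_bound(3)])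
       (use n in auto)
  finally show ?thesis by (simp add: ab)
qed

text \<open>The random indices \<open>v (Suc n)\<close> and
  \<open>innovations (\<lambda>k. \<epsilon> k \<omega>) n\<close> are summed over their possible
  values, so that each summand, multiplied by the deviation, has the form treated in the two
  preceding lemmas.\<close>

lemma AE_centred_Suc:
  assumes n: "1 \<le> n"
  shows "AE \<omega> in M. centred x (Suc n) \<omega> =
    (\<Sum>k = 1..n. centred x k \<omega> * (of_bool (\<epsilon> (Suc n) \<omega>) * of_bool (v (Suc n) \<omega> = k))) +
    (\<Sum>m = 0..n. of_bool (innovations (\<lambda>k. \<epsilon> k \<omega>) n = m) *
      (of_bool (\<not> \<epsilon> (Suc n) \<omega>) * (of_bool (U (Suc m) \<omega> \<le> x) - x)))"
  using AE_reinforced AE_v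
proof eventually_elim
  case (elim \<omega>)
  have U_hat: "U_hat (Suc n) \<omega> = (if \<epsilon> (Suc n) \<omega> then U_hat (v (Suc n) \<omega>) \<omega>
      else U (innovations (\<lambda>k. \<epsilon> k \<omega>) (Suc n)) \<omega>)"
    using elim(1) by simp
  have v: "v (Suc n) \<omega> \<in> {1..n}"
    using elim(2)[rule_format, of "Suc n"] n by auto
  show ?case
  proof (cases "\<epsilon> (Suc n) \<omega>")
    case True
    then have "centred x (Suc n) \<omega> = centred x (v (Suc n) \<omega>) \<omega>"
      by (simp add: centred_def U_hat)
    also have "\<dots> = (\<Sum>k = 1..n. if v (Suc n) \<omega> = k then centred x k \<omega> else 0)"
      using v by (subst sum.delta') auto
    also have "\<dots> = (\<Sum>k = 1..n. centred x k \<omega> * (of_bool (\<epsilon> (Suc n) \<omega>) * of_bool (v (Suc n) \<omega> = k)))"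
      by (intro sum.cong) (auto simp: True)
    finally show ?thesis by (simp add: True)
  next
    case False
    let ?i = "innovations (\<lambda>k. \<epsilon> k \<omega>) n"
    have "centred x (Suc n) \<omega> = of_bool (U (Suc ?i) \<omega> \<le> x) - x"
      using False by (simp add: centred_def U_hat innovations_Suc)
    also have "\<dots> = (\<Sum>m = 0..n. if ?i = m then of_bool (U (Suc m) \<omega> \<le> x) - x else 0)"
      using innovations_le by (subst sum.delta') auto
    also have "\<dots> = (\<Sum>m = 0..n. of_bool (?i = m) *
        (of_bool (\<not> \<epsilon> (Suc n) \<omega>) * (of_bool (U (Suc m) \<omega> \<le> x) - x)))"
      by (intro sum.cong) (auto simp: False)
    finally show ?thesis by (simp add: False)
  qed
qed

lemma measurable_innovations: "(\<lambda>\<omega>. innovations (\<lambda>k. \<epsilon> k \<omega>) n) \<in> M \<rightarrow>\<^sub>M count_space UNIV"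
proof -
  have "(\<lambda>\<omega>. 1 - of_bool (\<epsilon> k \<omega>) :: nat) \<in> M \<rightarrow>\<^sub>M count_space UNIV" if "k \<in> {1..n}" for k
  \<comment> \<open>The independent family starts at index 2, so measurability at index 1 comes from
    \<open>\<epsilon> 1\<close> being false on \<open>space M\<close>.\<close>
  proof (cases "k = 1")
    case True
    then show ?thesis using eps_first by (subst measurable_cong[where g = "\<lambda>_. 1"]) auto
  qed (use that in auto)
  then show ?thesis unfolding innovations_def by (intro measurable_sum_nat) auto
qed

text \<open>Innovation terms vanish in mean. The repetition terms all carry the weight
  \<open>p / n\<close>, so summing \<open>centred x k\<close> over \<open>k\<close> restores the
  deviation and produces its square.\<close>

lemma expectation_deviation_centred:
  assumes x: "x \<in> {0..1}" and n: "1 \<le> n"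
  shows "expectation (\<lambda>\<omega>. deviation x n \<omega> * centred x (Suc n) \<omega>) =
    p / real n * expectation (\<lambda>\<omega>. (deviation x n \<omega>)\<^sup>2)"
proof -
  define R where "R k \<omega> = deviation x n \<omega> * centred x k \<omega> *
      (of_bool (\<epsilon> (Suc n) \<omega>) * of_bool (v (Suc n) \<omega> = k))" for k \<omega>
  define I where "I m \<omega> = deviation x n \<omega> * of_bool (innovations (\<lambda>k. \<epsilon> k \<omega>) n = m) *
      (of_bool (\<not> \<epsilon> (Suc n) \<omega>) * (of_bool (U (Suc m) \<omega> \<le> x) - x))" for m \<omega>
  note [measurable] = measurable_innovations[of n]
  have [measurable]: "\<epsilon> (Suc n) \<in> M \<rightarrow>\<^sub>M count_space UNIV" "v (Suc n) \<in> M \<rightarrow>\<^sub>M count_space UNIV"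
    using n by auto
  have int_R: "integrable M (R k)" if "k \<in> {1..n}" for k
  proof -
    have [measurable]: "centred x k \<in> borel_measurable M" using that by (intro measurable_centred) auto
    show ?thesis
      unfolding R_def[abs_def] mult.assoc
      by (rule integrable_deviation_times[OF x, where c = 1]) (auto simp: abs_centred_le[OF x])
  qed
  have int_I: "integrable M (I m)" for m
  proof -
    have [measurable]: "U (Suc m) \<in> borel_measurable M" by simp
    show ?thesis
      unfolding I_def[abs_def] mult.assoc
      by (rule integrable_deviation_times[OF x, where c = 1]) (use abs_of_bool_diff_le[OF x] in auto)
  qed
  have "expectation (\<lambda>\<omega>. deviation x n \<omega> * centred x (Suc n) \<omega>) =
      expectation (\<lambda>\<omega>. (\<Sum>k = 1..n. R k \<omega>) + (\<Sum>m = 0..n. I m \<omega>))"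
  proof (rule integral_cong_AE)
    show "AE \<omega> in M. deviation x n \<omega> * centred x (Suc n) \<omega> = (\<Sum>k = 1..n. R k \<omega>) + (\<Sum>m = 0..n. I m \<omega>)"
      using AE_centred_Suc[OF n, of x]
      by eventually_elim (simp only: R_def I_def distrib_left sum_distrib_left mult.assoc)
    show "(\<lambda>\<omega>. (\<Sum>k = 1..n. R k \<omega>) + (\<Sum>m = 0..n. I m \<omega>)) \<in> borel_measurable M"
      using int_R int_I by (intro borel_measurable_add borel_measurable_sum borel_measurable_integrable)
    show "(\<lambda>\<omega>. deviation x n \<omega> * centred x (Suc n) \<omega>) \<in> borel_measurable M"
      by (intro borel_measurable_times measurable_deviation measurable_centred) simp
  qed
  also have "\<dots> = (\<Sum>k = 1..n. expectation (R k)) + (\<Sum>m = 0..n. expectation (I m))"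
    using int_R int_I
    by (subst Bochner_Integration.integral_add) (auto simp del: One_nat_def)
  also have "(\<Sum>m = 0..n. expectation (I m)) = 0"
    unfolding I_def by (intro sum.neutral ballI expectation_innovation x n)
  also have "(\<Sum>k = 1..n. expectation (R k)) =
      (\<Sum>k = 1..n. p / real n * expectation (\<lambda>\<omega>. deviation x n \<omega> * centred x k \<omega>))"
    unfolding R_def by (intro sum.cong refl expectation_repetition x)
  also have "\<dots> = p / real n * expectation (\<lambda>\<omega>. \<Sum>k = 1..n. deviation x n \<omega> * centred x k \<omega>)"
    by (subst Bochner_Integration.integral_sum)
       (auto simp: sum_distrib_left intro!: integrable_deviation_times[OF x, where c = 1] measurable_centred abs_centred_le x)
  also have "(\<lambda>\<omega>. \<Sum>k = 1..n. deviation x n \<omega> * centred x k \<omega>) = (\<lambda>\<omega>. (deviation x n \<omega>)\<^sup>2)"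
    unfolding sum_distrib_left[symmetric] by (simp add: deviation_def power2_eq_square)
  finally show ?thesis by simp
qed

text \<open>Expanding the square, the cross term gives \<open>2 * p / n\<close> times the second
  moment, and the squared increment is at most 1.\<close>

lemma expectation_deviation_sq_Suc_le:
  assumes x: "x \<in> {0..1}" and n: "1 \<le> n"
  shows "expectation (\<lambda>\<omega>. (deviation x (Suc n) \<omega>)\<^sup>2) \<le>
    (1 + 2 * p / real n) * expectation (\<lambda>\<omega>. (deviation x n \<omega>)\<^sup>2) + 1"
proof -
  have int: "integrable M (\<lambda>\<omega>. (deviation x n \<omega>)\<^sup>2)"
    "integrable M (\<lambda>\<omega>. deviation x n \<omega> * centred x (Suc n) \<omega>)"
    by (auto intro!: integrable_deviation_sq integrable_deviation_times[where c = 1]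
        measurable_centred abs_centred_le x)
  have "expectation (\<lambda>\<omega>. (deviation x (Suc n) \<omega>)\<^sup>2) \<le>
      expectation (\<lambda>\<omega>. (deviation x n \<omega>)\<^sup>2 + 2 * (deviation x n \<omega> * centred x (Suc n) \<omega>) + 1)"
  proof (rule integral_mono)
    fix \<omega>
    have "(centred x (Suc n) \<omega>)\<^sup>2 \<le> 1"
      using abs_centred_le[OF x, of "Suc n" \<omega>] by (simp add: abs_square_le_1)
    then show "(deviation x (Suc n) \<omega>)\<^sup>2 \<le>
        (deviation x n \<omega>)\<^sup>2 + 2 * (deviation x n \<omega> * centred x (Suc n) \<omega>) + 1"
      by (simp add: deviation_Suc power2_sum)
  qed (use int integrable_deviation_sq[OF x] in auto)
  also have "\<dots> = expectation (\<lambda>\<omega>. (deviation x n \<omega>)\<^sup>2) +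
      2 * expectation (\<lambda>\<omega>. deviation x n \<omega> * centred x (Suc n) \<omega>) + 1"
    using int by (simp add: prob_space)
  finally show ?thesis
    by (simp add: expectation_deviation_centred[OF x n] algebra_simps)
qed

section \<open>Almost sure convergence, pointwise and then uniform\<close>

lemma AE_deviation_tendsto_0:
  assumes x: "x \<in> {0..1}"
  shows "AE \<omega> in M. (\<lambda>n. deviation x n \<omega> / real n) \<longlonglongrightarrow> 0"
proof -
  have "summable (\<lambda>n. expectation (\<lambda>\<omega>. (deviation x n \<omega>)\<^sup>2) / real n ^ 3)"
    using p expectation_deviation_sq_Suc_le[OF x] by (intro summable_div_cube_if_recursion[where p = p]) auto
  then have "AE \<omega> in M. summable (\<lambda>n. (deviation x n \<omega>)\<^sup>2 / real n ^ 3)"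
    using integrable_deviation_sq[OF x] by (intro AE_summable_if_summable_expectation) auto
  then show ?thesis
  proof eventually_elim
    case (elim \<omega>)
    then show ?case
      using abs_centred_le[OF x] by (intro slowly_varying_div_tendsto_0) (auto simp: deviation_Suc)
  qed
qed

lemma AE_empirical_distribution_uniform:
  "AE \<omega> in M. (\<lambda>n. SUP x\<in>{0..1}. \<bar>1 / real n * (\<Sum>i = 1..n. (of_bool (U_hat i \<omega> \<le> x) - x))\<bar>)
    \<longlonglongrightarrow> 0"
proof -
  \<comment> \<open>Rational points are used because the exceptional null sets must be countably
    many.\<close>
  have "AE \<omega> in M. \<forall>x\<in>\<rat> \<inter> {0..1}. (\<lambda>n. deviation x n \<omega> / real n) \<longlonglongrightarrow> 0"
    by (subst AE_ball_countable) (auto simp: countable_rat AE_deviation_tendsto_0)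
  then show ?thesis
  proof eventually_elim
    case (elim \<omega>)
    define G where "G n x = (\<Sum>i = 1..n. of_bool (U_hat i \<omega> \<le> x)) / real n" for n and x :: real
    \<comment> \<open>At \<open>n = 0\<close> division by zero makes the left side 0 and the right
      side \<open>- x\<close>, so limits are transferred by eventual equality.\<close>
    have G: "1 / real n * (\<Sum>i = 1..n. (of_bool (U_hat i \<omega> \<le> x) - x)) = G n x - x"
      if "1 \<le> n" for n x
      using that by (simp add: G_def sum_subtractf diff_divide_distrib)
    have "(\<lambda>n. SUP x\<in>{0..1}. \<bar>G n x - x\<bar>) \<longlonglongrightarrow> 0"
    proof (rule uniform_limit_of_mono)
      show "mono (G n)" for n
        unfolding G_def by (intro monoI divide_right_mono sum_mono) auto
    next
      fix x :: real assume "x \<in> \<rat>" "x \<in> {0..1}"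
      then have "(\<lambda>n. deviation x n \<omega> / real n) \<longlonglongrightarrow> 0" using elim by auto
      then have "(\<lambda>n. G n x - x) \<longlonglongrightarrow> 0"
        by (rule Lim_transform_eventually)
           (auto intro!: eventually_sequentiallyI[of 1] simp: G[symmetric] deviation_def centred_def)
      then show "(\<lambda>n. G n x) \<longlonglongrightarrow> x" by (simp add: LIM_zero_iff)
    qed
    then show ?case
      by (rule Lim_transform_eventually) (auto intro!: eventually_sequentiallyI[of 1] simp only: G)
  qed
qed

end

theorem proposition1p1:
  fixes M :: "'w measure" and p :: real
    and \<epsilon> :: "nat \<Rightarrow> 'w \<Rightarrow> bool"
    and v :: "nat \<Rightarrow> 'w \<Rightarrow> nat"
    and U :: "nat \<Rightarrow> 'w \<Rightarrow> real"
  assumes "simon_algorithm M p \<epsilon> v U"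
  shows "AE \<omega> in M.
    (\<lambda>n. SUP x\<in>{0..1}.
       \<bar>1 / real n * (\<Sum>i = 1..n. (of_bool (simon_algorithm.U_hat \<epsilon> v U i \<omega> \<le> x) - x))\<bar>)
    \<longlonglongrightarrow> 0"
  using assms by (rule simon_algorithm.AE_empirical_distribution_uniform)

end
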